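(* Let $\mathbf{A}\in\mathbb{R}^{n\times n}$ be symmetric positive semi-definite, let $1\le k\le d\le n$ be integers, let $0<\varepsilon^*\le\frac12$, $\varepsilon=\frac49\varepsilon^*$, $0<\delta<1$, and $N=2nd+n+d$. Let $\mathbf{\Omega}\in\mathbb{R}^{l\times n}$ be a random matrix that is both a $(\frac13,\delta,d)$ OSE and a $\left(\sqrt{\frac{\varepsilon}{d}},\frac{\delta}{N},1\right)$ OSE. Then, with probability at least $1-2\delta$, the Nyström approximation satisfies $$\|\mathbf{A}-[\![\mathbf{A}]\!]^{(\mathrm{Nyst})}\|_{*}\le(1+\varepsilon^* )\,\|\mathbf{A}-[\![\mathbf{A}]\!]_d\|_{*},$$ and, for both $\xi=2$ and $\xi=*$, $$\|\mathbf{A}-[\![\mathbf{A}]\!]^{(\mathrm{Nyst})}_k\|_{\xi}\le\|\mathbf{A}-[\![\mathbf{A}]\!]_k\|_{\xi}+3\,\|\mathbf{A}-[\![\mathbf{A}]\!]_d\|_{*}.$$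
   Context: OSE: for $0\le\varepsilon<1$ and $0<\delta<1$, a random matrix $\mathbf{\Omega}\in\mathbb{R}^{l\times n}$ is an $(\varepsilon,\delta,d)$ oblivious $\ell_2$-subspace embedding (OSE) if for any fixed $d$-dimensional subspace $V\subseteq\mathbb{R}^n$, with probability at least $1-\delta$ it holds that for all $\mathbf{x}\in V$, $\left|\,\|\mathbf{x}\|_2^2-\|\mathbf{\Omega}\mathbf{x}\|_2^2\right|\le\varepsilon\|\mathbf{x}\|_2^2$. $\|\cdot\|_2$ is the spectral norm and $\|\cdot\|_*$ the trace (nuclear) norm. For a matrix $\mathbf{B}$, $[\![\mathbf{B}]\!]_k$ denotes its best rank-$k$ approximation given by the truncated singular value decomposition. The Nyström approximation of $\mathbf{A}$ associated with $\mathbf{\Omega}$ is $$[\![\mathbf{A}]\!]^{(\mathrm{Nyst})}=(\mathbf{\Omega}\mathbf{A})^{\mathrm T}(\mathbf{\Omega}\mathbf{A}\mathbf{\Omega}^{\mathrm T})^{\dagger}(\mathbf{\Omega}\mathbf{A}),$$ with $\dagger$ the Moore–Penrose pseudo-inverse, and its rank-$k$ truncation is $[\![\mathbf{A}]\!]^{(\mathrm{Nyst})}_k=[\![\,[\![\mathbf{A}]\!]^{(\mathrm{Nyst})}]\!]_k$. *)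

theory Defs
  imports "HOL-Analysis.Analysis" "HOL-Probability.Probability"
begin

definition pos_semidef :: "real^'n^'n \<Rightarrow> bool" where
  "pos_semidef A \<longleftrightarrow> transpose A = A \<and> (\<forall>x. 0 \<le> x \<bullet> (A *v x))"

definition outer_prod :: "real^'m \<Rightarrow> real^'n \<Rightarrow> real^'n^'m" where
  "outer_prod u v = (\<chi> i j. u $ i * v $ j)"

definition orthonormal_upto :: "nat \<Rightarrow> (nat \<Rightarrow> 'a::euclidean_space) \<Rightarrow> bool" where
  "orthonormal_upto r u \<longleftrightarrow> (\<forall>i<r. \<forall>j<r. u i \<bullet> u j = (if i = j then 1 else 0))"

definition min_dim :: "real^'n^'m \<Rightarrow> nat" where
  "min_dim B = min CARD('m) CARD('n)"

text \<open>
  Thin singular value decomposition, in dyadic form: the triples \<open>u i\<close>, \<open>s i\<close>, \<open>v i\<close> with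
  \<open>i < min_dim B\<close> are the left singular vectors, the singular values in decreasing order (zeros
  included) and the right singular vectors. Values at larger indices are irrelevant.
\<close>
definition is_svd ::
  "real^'n^'m \<Rightarrow> (nat \<Rightarrow> real^'m) \<Rightarrow> (nat \<Rightarrow> real) \<Rightarrow> (nat \<Rightarrow> real^'n) \<Rightarrow> bool" where
  "is_svd B u s v \<longleftrightarrow>
     orthonormal_upto (min_dim B) u \<and>
     orthonormal_upto (min_dim B) v \<and>
     (\<forall>i<min_dim B. 0 \<le> s i) \<and>
     (\<forall>i j. i \<le> j \<and> j < min_dim B \<longrightarrow> s j \<le> s i) \<and>
     B = (\<Sum>i<min_dim B. s i *\<^sub>R outer_prod (u i) (v i))"

text \<open>
  The truncation of an SVD is not unique when the \<open>k\<close>-th and \<open>(k+1)\<close>-st singular values coincide,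
  so it is a relation between a matrix and its best rank-\<open>k\<close> approximations.
\<close>
definition is_truncated_svd :: "nat \<Rightarrow> real^'n^'m \<Rightarrow> real^'n^'m \<Rightarrow> bool" where
  "is_truncated_svd k B Bk \<longleftrightarrow>
     (\<exists>u s v. is_svd B u s v \<and>
        Bk = (\<Sum>i<min k (min_dim B). s i *\<^sub>R outer_prod (u i) (v i)))"

definition spectral_norm :: "real^'n^'m \<Rightarrow> real" where
  "spectral_norm B = onorm (\<lambda>x. B *v x)"

text \<open>The sum of the singular values, which is the same for every SVD.\<close>
definition nuclear_norm :: "real^'n^'m \<Rightarrow> real" where
  "nuclear_norm B = (THE t. \<exists>u s v. is_svd B u s v \<and> t = (\<Sum>i<min_dim B. s i))"

text \<open>The Moore--Penrose pseudo-inverse, as the unique solution of the four Penrose equations.\<close>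
definition pinv :: "real^'n^'m \<Rightarrow> real^'m^'n" where
  "pinv B = (THE X. B ** X ** B = B \<and> X ** B ** X = X \<and>
                    transpose (B ** X) = B ** X \<and> transpose (X ** B) = X ** B)"

definition nystrom :: "real^'n^'n \<Rightarrow> real^'n^'l \<Rightarrow> real^'n^'n" where
  "nystrom A W = transpose (W ** A) ** pinv (W ** A ** transpose W) ** (W ** A)"

text \<open>
  For measurable \<open>{x \<in> space M. P x}\<close> this says that this event has probability at least \<open>p\<close>;
  otherwise it bounds the inner measure.
\<close>
definition with_prob_at_least :: "'w measure \<Rightarrow> real \<Rightarrow> ('w \<Rightarrow> bool) \<Rightarrow> bool" where
  "with_prob_at_least M p P \<longleftrightarrow> (\<exists>E\<in>sets M. p \<le> measure M E \<and> (\<forall>x\<in>E. P x))"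

definition OSE :: "'w measure \<Rightarrow> ('w \<Rightarrow> real^'n^'l) \<Rightarrow> real \<Rightarrow> real \<Rightarrow> nat \<Rightarrow> bool" where
  "OSE M Omega \<epsilon> \<delta> d \<longleftrightarrow>
     0 \<le> \<epsilon> \<and> \<epsilon> < 1 \<and> 0 < \<delta> \<and> \<delta> < 1 \<and>
     (\<forall>V :: (real^'n) set. subspace V \<and> dim V = d \<longrightarrow>
        with_prob_at_least M (1 - \<delta>)
          (\<lambda>w. \<forall>x\<in>V. \<bar>(norm x)\<^sup>2 - (norm (Omega w *v x))\<^sup>2\<bar> \<le> \<epsilon> * (norm x)\<^sup>2))"

end

theory Submission
  imports Defs
begin

text \<open>
  Write \<open>W\<close> for a sample of \<open>Omega\<close> and \<open>E = A - nystrom A W\<close>. Then \<open>0 \<le> E \<le> A\<close> in the Loewner order and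
  \<open>E W\<^sup>T = 0\<close>, so \<open>E = H E H\<^sup>T\<close> and hence \<open>trace E \<le> trace (H A H\<^sup>T)\<close> for every \<open>H = I - C W\<close>. Let \<open>v\<^sub>j\<close> be
  the eigenvectors of \<open>A\<close> with eigenvalues \<open>s\<^sub>j\<close>, and let \<open>C\<close> be the left inverse of \<open>W\<close> on the span of the
  leading \<open>d\<close> of them. The \<open>(1/3, \<delta>, d)\<close> embedding bounds this left inverse, the one-dimensional
  embedding applied to \<open>v\<^sub>i \<plusminus> v\<^sub>j\<close> bounds the inner products of \<open>W v\<^sub>i\<close> (\<open>i < d\<close>) and \<open>W v\<^sub>j\<close> (\<open>j \<ge> d\<close>), and
  together they give \<open>trace (H A H\<^sup>T) \<le> (1 + 9/4 \<epsilon>) (s\<^sub>d + \<dots>)\<close>. For the rank-\<open>k\<close> truncation the triangle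
  inequality isolates \<open>E\<close>, and since \<open>nystrom A W \<le> A\<close> the remaining tail of singular values is at most that
  of \<open>A\<close> (Courant--Fischer for the spectral norm, Ky Fan for the nuclear norm).
\<close>

subsection \<open>Matrices and outer products\<close>

lemma transpose_mult_inner:
  fixes B :: "real^'n^'m"
  shows "(transpose B *v x) \<bullet> y = x \<bullet> (B *v y)"
  by (simp add: dot_lmul_matrix)

lemma outer_prod_mult_vec: "outer_prod u v *v x = (v \<bullet> x) *\<^sub>R u"
  by (simp add: vec_eq_iff matrix_vector_mult_def outer_prod_def inner_vec_def sum_distrib_left mult_ac)

lemma sum_matrix_mult_vec:
  fixes B :: "'i \<Rightarrow> real^'n^'m"
  shows "(\<Sum>i\<in>I. B i) *v x = (\<Sum>i\<in>I. B i *v x)"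
  by (induction I rule: infinite_finite_induct) (auto simp: matrix_vector_mult_add_rdistrib)

lemma scaleR_outer_sum_mult_vec:
  "(\<Sum>i\<in>I. c i *\<^sub>R outer_prod (u i) (v i)) *v x = (\<Sum>i\<in>I. (c i * (v i \<bullet> x)) *\<^sub>R u i)"
  by (simp add: sum_matrix_mult_vec scaleR_matrix_vector_assoc[symmetric] outer_prod_mult_vec)

text \<open>Left and right singular vectors of a zero singular value may differ. Agreement of the
  scaled vectors is enough to exchange them in a dyadic sum.\<close>

lemma scaleR_outer_prod_cong:
  assumes "c *\<^sub>R u = c *\<^sub>R u'"
  shows "c *\<^sub>R outer_prod u v = c *\<^sub>R outer_prod u' v"
  using assms by (simp add: vec_eq_iff outer_prod_def flip: mult.assoc)

lemma transpose_outer_prod: "transpose (outer_prod u v) = outer_prod v u"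
  by (simp add: vec_eq_iff transpose_def outer_prod_def)

lemma trace_outer_prod: "trace (outer_prod u v) = u \<bullet> v"
  by (simp add: trace_def outer_prod_def inner_vec_def)

lemma trace_scaleR: "trace (c *\<^sub>R B) = c * trace (B :: real^'n^'n)"
  by (simp add: trace_def sum_distrib_left)

lemma trace_sum: "trace (\<Sum>i\<in>I. B i) = (\<Sum>i\<in>I. trace (B i :: real^'n^'n))"
  unfolding trace_def sum_component by (rule sum.swap)

lemma transpose_add: "transpose (A + B) = transpose A + transpose B"
  by (simp add: vec_eq_iff transpose_def)

lemma transpose_diff: "transpose (A - B) = transpose A - transpose B"
  by (simp add: vec_eq_iff transpose_def)

lemma transpose_sum: "transpose (\<Sum>i\<in>I. B i :: real^'n^'m) = (\<Sum>i\<in>I. transpose (B i))"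
  by (simp add: vec_eq_iff transpose_def)

subsection \<open>Orthonormal systems\<close>

lemma orthonormal_uptoD:
  "orthonormal_upto r u \<Longrightarrow> i < r \<Longrightarrow> j < r \<Longrightarrow> u i \<bullet> u j = (if i = j then 1 else 0)"
  by (simp add: orthonormal_upto_def)

lemma orthonormal_upto_mono: "orthonormal_upto r u \<Longrightarrow> q \<le> r \<Longrightarrow> orthonormal_upto q u"
  by (simp add: orthonormal_upto_def)

lemma orthonormal_upto_inner_sum:
  assumes "orthonormal_upto r u" "I \<subseteq> {..<r}" "j < r"
  shows "u j \<bullet> (\<Sum>i\<in>I. c i *\<^sub>R u i) = (if j \<in> I then c j else 0)"
proof -
  have fin: "finite I" using assms(2) finite_subset by blast
  have "u j \<bullet> (\<Sum>i\<in>I. c i *\<^sub>R u i) = (\<Sum>i\<in>I. if i = j then c i else 0)"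
    unfolding inner_sum_right using assms
    by (intro sum.cong) (auto simp: orthonormal_uptoD subset_iff)
  then show ?thesis using fin by simp
qed

lemma orthonormal_upto_norm_sum:
  assumes "orthonormal_upto r u" "I \<subseteq> {..<r}"
  shows "(norm (\<Sum>i\<in>I. c i *\<^sub>R u i))\<^sup>2 = (\<Sum>i\<in>I. (c i)\<^sup>2)"
proof -
  have "(norm (\<Sum>i\<in>I. c i *\<^sub>R u i))\<^sup>2 = (\<Sum>j\<in>I. c j * (u j \<bullet> (\<Sum>i\<in>I. c i *\<^sub>R u i)))"
    unfolding power2_norm_eq_inner by (subst inner_sum_left) simp
  also have "\<dots> = (\<Sum>j\<in>I. (c j)\<^sup>2)"
    using assms by (intro sum.cong) (auto simp: orthonormal_upto_inner_sum[OF assms] power2_eq_square subset_iff)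
  finally show ?thesis .
qed

lemma orthonormal_upto_norm: "orthonormal_upto r u \<Longrightarrow> i < r \<Longrightarrow> norm (u i) = 1"
  by (simp add: orthonormal_upto_def norm_eq_sqrt_inner)

lemma orthonormal_upto_inj: "orthonormal_upto r u \<Longrightarrow> inj_on u {..<r}"
  by (rule inj_onI) (metis lessThan_iff orthonormal_uptoD zero_neq_one)

lemma orthonormal_upto_independent:
  assumes "orthonormal_upto r u"
  shows "independent (u ` {..<r})"
proof (rule pairwise_orthogonal_independent)
  show "pairwise orthogonal (u ` {..<r})"
    using assms by (auto simp: pairwise_def orthogonal_def orthonormal_upto_def)
  show "0 \<notin> u ` {..<r}" using orthonormal_upto_norm[OF assms] by force
qed

lemma orthonormal_upto_dim_span:
  assumes "orthonormal_upto r u"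
  shows "dim (span (u ` {..<r})) = r"
  using dim_span_eq_card_independent[OF orthonormal_upto_independent[OF assms]]
  by (simp add: card_image orthonormal_upto_inj[OF assms])

text \<open>A full-length orthonormal system spans the space, so the difference of \<open>x\<close>
  and \<open>y\<close> is orthogonal to itself. Matrix identities can then be checked coordinatewise
  in an eigenbasis.\<close>

lemma orthonormal_basis_eqI:
  fixes u :: "nat \<Rightarrow> 'a::euclidean_space"
  assumes "orthonormal_upto (DIM('a)) u" and eq: "\<And>i. i < DIM('a) \<Longrightarrow> u i \<bullet> x = u i \<bullet> y"
  shows "x = y"
proof -
  have "span (u ` {..<DIM('a)}) = UNIV"
    using orthonormal_upto_dim_span[OF assms(1)] by (metis dim_eq_full dim_span span_span)
  moreover have "orthogonal (x - y) z" if "z \<in> u ` {..<DIM('a)}" for z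
    using that eq by (auto simp: orthogonal_def inner_diff_left inner_diff_right inner_commute)
  ultimately have "orthogonal (x - y) (x - y)"
    by (metis UNIV_I orthogonal_to_span)
  then show ?thesis by (simp add: orthogonal_def)
qed

lemma orthonormal_basis_expansion:
  fixes u :: "nat \<Rightarrow> 'a::euclidean_space"
  assumes "orthonormal_upto (DIM('a)) u"
  shows "(\<Sum>i<DIM('a). (u i \<bullet> x) *\<^sub>R u i) = x"
  by (rule orthonormal_basis_eqI[OF assms]) (simp add: orthonormal_upto_inner_sum[OF assms])

lemma parseval:
  fixes u :: "nat \<Rightarrow> 'a::euclidean_space"
  assumes "orthonormal_upto (DIM('a)) u"
  shows "(\<Sum>i<DIM('a). (u i \<bullet> x)\<^sup>2) = (norm x)\<^sup>2"
  using orthonormal_upto_norm_sum[OF assms, of "{..<DIM('a)}" "\<lambda>i. u i \<bullet> x"]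
  by (simp add: orthonormal_basis_expansion[OF assms])

subsection \<open>Positive semidefinite matrices\<close>

lemma pos_semidefD:
  assumes "pos_semidef A"
  shows "transpose A = A" "0 \<le> x \<bullet> (A *v x)"
  using assms by (auto simp: pos_semidef_def)

lemma pos_semidef_inner_commute:
  assumes "pos_semidef A"
  shows "(A *v x) \<bullet> y = x \<bullet> (A *v y)"
  using transpose_mult_inner[of A x y] pos_semidefD(1)[OF assms] by simp

text \<open>The degenerate case of Cauchy--Schwarz for the semi-inner product \<open>x \<bullet> (A *v y)\<close> on \<open>S\<close>.\<close>
lemma quadratic_form_zero_imp_orthogonal:
  fixes A :: "real^'n^'n"
  assumes sym: "transpose A = A" and S: "subspace S" and psd: "\<And>z. z \<in> S \<Longrightarrow> 0 \<le> z \<bullet> (A *v z)"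
    and "x \<in> S" "y \<in> S" and zero: "x \<bullet> (A *v x) = 0"
  shows "y \<bullet> (A *v x) = 0"
proof (rule ccontr)
  define b c where "b = y \<bullet> (A *v x)" and "c = y \<bullet> (A *v y)"
  have xy: "x \<bullet> (A *v y) = b"
    using transpose_mult_inner[of A x y] by (simp only: sym b_def) (simp add: inner_commute)
  assume "y \<bullet> (A *v x) \<noteq> 0"
  then have b: "b \<noteq> 0" by (simp add: b_def)
  have c: "0 \<le> c" using psd assms(5) by (simp add: c_def)
  \<comment> \<open>With this \<open>t\<close> the quadratic form at
    \<open>t *\<^sub>R x + y\<close> equals \<open>- c - 2\<close>, which is negative.\<close>
  define t where "t = - (c + 1) / b"
  have "t *\<^sub>R x + y \<in> S" using S assms by (simp add: subspace_add subspace_scale)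
  from psd[OF this] have "0 \<le> 2 * (t * b) + c"
    by (simp add: matrix_vector_right_distrib matrix_vector_mult_scaleR inner_add_left inner_add_right
        zero xy mult.commute flip: b_def c_def)
  also have "t * b = - (c + 1)" using b by (simp add: t_def)
  finally show False using c by simp
qed

lemma pos_semidef_kernel:
  assumes "pos_semidef A" "x \<bullet> (A *v x) = 0"
  shows "A *v x = 0"
  using quadratic_form_zero_imp_orthogonal[of A UNIV x "A *v x"] assms
  by (simp add: pos_semidef_def)

section \<open>Spectral theorem and symmetric singular value decompositions\<close>

text \<open>Eigenvectors are found one by one, maximizing the quadratic form on the unit sphere of
  the orthogonal complement of the earlier ones. The maximality clause later puts the eigenvalues in
  decreasing order.\<close>

lemma spectral_theorem_partial:
  fixes A :: "real^'n^'n"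
  assumes sym: "transpose A = A" and "r \<le> CARD('n)"
  shows "\<exists>u s. orthonormal_upto r u \<and> (\<forall>i<r. A *v u i = s i *\<^sub>R u i) \<and>
    (\<forall>i<r. \<forall>x. norm x = 1 \<and> (\<forall>j<i. u j \<bullet> x = 0) \<longrightarrow> x \<bullet> (A *v x) \<le> s i)"
  using assms(2)
proof (induction r)
  case 0
  then show ?case by (simp add: orthonormal_upto_def)
next
  case (Suc r)
  then obtain u s where on: "orthonormal_upto r u" and eig: "\<forall>i<r. A *v u i = s i *\<^sub>R u i"
    and mx: "\<forall>i<r. \<forall>x. norm x = 1 \<and> (\<forall>j<i. u j \<bullet> x = 0) \<longrightarrow> x \<bullet> (A *v x) \<le> s i"
    by auto
  define S where "S = {x. \<forall>j<r. u j \<bullet> x = 0}"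
  have S: "subspace S" by (auto simp: S_def subspace_def inner_add_right)
  have closed: "closed S"
  proof -
    have "S = (\<Inter>j<r. {x. u j \<bullet> x = 0})" by (auto simp: S_def)
    then show ?thesis by (auto simp: closed_hyperplane)
  qed
  have "dim (span (u ` {..<r})) < DIM(real^'n)"
    using Suc.prems orthonormal_upto_dim_span[OF on] by simp
  then obtain y where "y \<noteq> 0" and y: "\<And>z. z \<in> span (u ` {..<r}) \<Longrightarrow> orthogonal y z"
    using orthogonal_to_subspace_exists by (metis dim_span)
  have "u j \<bullet> y = 0" if "j < r" for j
    using y[OF span_base, of "u j"] that by (simp add: orthogonal_def inner_commute)
  with \<open>y \<noteq> 0\<close> have "y /\<^sub>R norm y \<in> S \<inter> sphere 0 1" by (simp add: S_def)
  then have ne: "S \<inter> sphere 0 1 \<noteq> {}" by blast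
  have "compact (S \<inter> sphere 0 1)" using closed by (simp add: closed_Int_compact)
  moreover have "continuous_on (S \<inter> sphere 0 1) (\<lambda>x. x \<bullet> (A *v x))"
    by (intro continuous_intros matrix_vector_mult_linear_continuous_on)
  ultimately obtain x where x: "x \<in> S" "norm x = 1"
    and xmax: "\<And>z. z \<in> S \<Longrightarrow> norm z = 1 \<Longrightarrow> z \<bullet> (A *v z) \<le> x \<bullet> (A *v x)"
    using continuous_attains_sup[OF _ ne, of "\<lambda>x. x \<bullet> (A *v x)"] by auto
  define t where "t = x \<bullet> (A *v x)"
  \<comment> \<open>By symmetry, the complement of a span of eigenvectors is invariant.\<close>
  have AS: "A *v z \<in> S" if "z \<in> S" for z
    unfolding S_def
  proof safe
    fix j assume j: "j < r"
    have "u j \<bullet> (A *v z) = (A *v u j) \<bullet> z"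
      using transpose_mult_inner[of A "u j" z] by (simp only: sym)
    then show "u j \<bullet> (A *v z) = 0" using that j eig by (simp add: S_def)
  qed
  text \<open>The matrix \<open>t - A\<close> is nonnegative on the invariant subspace \<open>S\<close>, and its quadratic form
    vanishes at the maximizer \<open>x\<close>.\<close>
  define C where "C = t *\<^sub>R mat 1 - A"
  have Cv: "C *v z = t *\<^sub>R z - A *v z" for z
    by (simp add: C_def matrix_vector_mult_diff_rdistrib scaleR_matrix_vector_assoc[symmetric])
  have "transpose C = C" by (simp add: C_def transpose_diff transpose_scalar sym)
  moreover have "0 \<le> z \<bullet> (C *v z)" if "z \<in> S" for z
  proof (cases "z = 0")
    case False
    have "(z /\<^sub>R norm z) \<bullet> (A *v (z /\<^sub>R norm z)) \<le> t"
      unfolding t_def using that False S by (intro xmax) (auto simp: subspace_scale)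
    then have "z \<bullet> (A *v z) / (norm z)\<^sup>2 \<le> t"
      by (simp add: matrix_vector_mult_scaleR power2_eq_square divide_inverse mult_ac)
    then show ?thesis using False
      by (simp add: Cv inner_diff_right field_simps flip: power2_norm_eq_inner)
  qed simp
  \<comment> \<open>Invariance allows \<open>C *v x\<close> itself as the test vector, so that its
    squared norm vanishes.\<close>
  moreover have CS: "C *v x \<in> S"
    unfolding Cv by (intro subspace_diff[OF S] subspace_scale[OF S] AS x)
  moreover have "x \<bullet> (C *v x) = 0" using x by (simp add: Cv inner_diff_right t_def norm_eq_1)
  ultimately have "(C *v x) \<bullet> (C *v x) = 0"
    using quadratic_form_zero_imp_orthogonal[OF _ S] x by blast
  then have "A *v x = t *\<^sub>R x" by (simp add: Cv)
  moreover have "orthonormal_upto (Suc r) (\<lambda>i. if i = r then x else u i)"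
    using on x by (auto simp: orthonormal_upto_def S_def norm_eq_1 inner_commute less_Suc_eq)
  ultimately show ?case
    using eig mx xmax
    by (intro exI[of _ "\<lambda>i. if i = r then x else u i"] exI[of _ "\<lambda>i. if i = r then t else s i"]) (auto simp: less_Suc_eq S_def t_def)
qed

lemma pos_semidef_svd_exists:
  fixes A :: "real^'n^'n"
  assumes "pos_semidef A"
  obtains s v where "is_svd A v s v"
proof -
  obtain u s where on: "orthonormal_upto CARD('n) u" and eig: "\<forall>i<CARD('n). A *v u i = s i *\<^sub>R u i"
    and mx: "\<forall>i<CARD('n). \<forall>x. norm x = 1 \<and> (\<forall>j<i. u j \<bullet> x = 0) \<longrightarrow> x \<bullet> (A *v x) \<le> s i"
    using spectral_theorem_partial[OF pos_semidefD(1)[OF assms] order_refl] by auto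
  have on': "orthonormal_upto (DIM(real^'n)) u" using on by simp
  have val: "u i \<bullet> (A *v u i) = s i" if "i < CARD('n)" for i
    using that eig on by (simp add: orthonormal_uptoD)
  have "A = (\<Sum>i<CARD('n). s i *\<^sub>R outer_prod (u i) (u i))"
    unfolding matrix_eq
  proof (rule allI, rule orthonormal_basis_eqI[OF on'])
    fix x i assume "i < DIM(real^'n)"
    then show "u i \<bullet> (A *v x) = u i \<bullet> ((\<Sum>i<CARD('n). s i *\<^sub>R outer_prod (u i) (u i)) *v x)"
      unfolding scaleR_outer_sum_mult_vec
      by (subst orthonormal_upto_inner_sum[OF on])
         (auto simp: eig simp flip: pos_semidef_inner_commute[OF assms])
  qed
  moreover have "s j \<le> s i" if "i \<le> j" "j < CARD('n)" for i j
  proof -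
    have "\<forall>k<i. u k \<bullet> u j = 0" using that on by (auto simp: orthonormal_uptoD)
    then show ?thesis using mx[rule_format, of i "u j"] that val[of j] orthonormal_upto_norm[OF on] by simp
  qed
  moreover have "0 \<le> s i" if "i < CARD('n)" for i
    using val[OF that] pos_semidefD(2)[OF assms] by metis
  ultimately show thesis using on by (intro that[of u s]) (simp add: is_svd_def min_dim_def)
qed

text \<open>The nuclear norm and the truncation refer to arbitrary decompositions. This reduces each
  of them to an eigendecomposition.\<close>

lemma pos_semidef_svd_symmetric:
  fixes A :: "real^'n^'n"
  assumes psd: "pos_semidef A" and svd: "is_svd A u s v"
  shows "i < CARD('n) \<Longrightarrow> s i *\<^sub>R u i = s i *\<^sub>R v i" and "is_svd A v s v"
proof -
  have on: "orthonormal_upto CARD('n) u" "orthonormal_upto CARD('n) v"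
    and s: "\<And>i. i < CARD('n) \<Longrightarrow> 0 \<le> s i"
    and A: "A = (\<Sum>i<CARD('n). s i *\<^sub>R outer_prod (u i) (v i))"
    using svd by (auto simp: is_svd_def min_dim_def)
  have At: "A = (\<Sum>i<CARD('n). s i *\<^sub>R outer_prod (v i) (u i))"
    using A pos_semidefD(1)[OF psd] by (metis (no_types, lifting) sum.cong transpose_sum transpose_scalar transpose_outer_prod)
  show eq: "s i *\<^sub>R u i = s i *\<^sub>R v i" if i: "i < CARD('n)" for i
  proof (cases "s i = 0")
    case False
    have Av: "A *v v i = s i *\<^sub>R u i"
    proof -
      have "A *v v i = (\<Sum>j<CARD('n). if j = i then s i *\<^sub>R u i else 0)"
        unfolding A scaleR_outer_sum_mult_vec using i on by (intro sum.cong) (auto simp: orthonormal_uptoD)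
      then show ?thesis using i by simp
    qed
    have Au: "A *v u i = s i *\<^sub>R v i"
    proof -
      have "A *v u i = (\<Sum>j<CARD('n). if j = i then s i *\<^sub>R v i else 0)"
        unfolding At scaleR_outer_sum_mult_vec using i on by (intro sum.cong) (auto simp: orthonormal_uptoD)
      then show ?thesis using i by simp
    qed
    \<comment> \<open>A nonzero difference would be an eigenvector with a negative
      eigenvalue.\<close>
    have "A *v (u i - v i) = - s i *\<^sub>R (u i - v i)"
      by (simp add: matrix_vector_mult_diff_distrib Au Av algebra_simps)
    then have "0 \<le> - s i * ((u i - v i) \<bullet> (u i - v i))"
      using pos_semidefD(2)[OF psd, of "u i - v i"] by simp
    moreover have "0 < s i" using False s[OF i] by simp
    ultimately have "(u i - v i) \<bullet> (u i - v i) \<le> 0" by (simp add: zero_le_mult_iff mult_le_0_iff)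
    then have "u i - v i = 0" by (metis inner_ge_zero inner_eq_zero_iff antisym)
    then show ?thesis by simp
  qed simp
  have "s i *\<^sub>R outer_prod (u i) (v i) = s i *\<^sub>R outer_prod (v i) (v i)" if "i < CARD('n)" for i
    by (intro scaleR_outer_prod_cong eq that)
  then have "A = (\<Sum>i<CARD('n). s i *\<^sub>R outer_prod (v i) (v i))"
    by (subst A) (intro sum.cong, auto)
  then show "is_svd A v s v" using svd by (simp add: is_svd_def min_dim_def)
qed

section \<open>Traces, congruences and dyadic sums\<close>

lemma transpose_mult_vec_inner:
  fixes B :: "real^'n^'m"
  shows "x \<bullet> (transpose B *v y) = (B *v x) \<bullet> y"
proof -
  have "x \<bullet> (transpose B *v y) = (transpose B *v y) \<bullet> x" by (rule inner_commute)
  also have "\<dots> = y \<bullet> (B *v x)" by (rule transpose_mult_inner)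
  also have "\<dots> = (B *v x) \<bullet> y" by (rule inner_commute)
  finally show ?thesis .
qed

declare transpose_matrix_vector [simp del]

lemma trace_eq_sum_axis:
  fixes B :: "real^'n^'n"
  shows "trace B = (\<Sum>i\<in>UNIV. axis i 1 \<bullet> (B *v axis i 1))"
  unfolding trace_def inner_axis' matrix_vector_mult_basis column_def by simp

lemma trace_mono:
  fixes A B :: "real^'n^'n"
  assumes "\<And>x. x \<bullet> (A *v x) \<le> x \<bullet> (B *v x)"
  shows "trace A \<le> trace B"
  unfolding trace_eq_sum_axis by (intro sum_mono assms)

lemma pos_semidef_trace_nonneg: "pos_semidef A \<Longrightarrow> 0 \<le> trace A"
  unfolding trace_eq_sum_axis by (simp add: sum_nonneg pos_semidefD(2))

lemma pos_semidef_add: "pos_semidef A \<Longrightarrow> pos_semidef B \<Longrightarrow> pos_semidef (A + B)"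
  by (simp add: pos_semidef_def transpose_add matrix_vector_mult_add_rdistrib inner_add_right)

lemma pos_semidef_congruence:
  fixes A :: "real^'n^'n" and H :: "real^'n^'m"
  assumes "pos_semidef A"
  shows "pos_semidef (H ** A ** transpose H)"
  unfolding pos_semidef_def
proof (intro conjI allI)
  show "transpose (H ** A ** transpose H) = H ** A ** transpose H"
    by (simp add: matrix_transpose_mul matrix_mul_assoc pos_semidefD[OF assms])
  fix x
  have "x \<bullet> (H ** A ** transpose H *v x) = (transpose H *v x) \<bullet> (A *v (transpose H *v x))"
    unfolding transpose_mult_inner by (simp only: matrix_vector_mul_assoc matrix_mul_assoc)
  then show "0 \<le> x \<bullet> (H ** A ** transpose H *v x)" using pos_semidefD(2)[OF assms] by simp
qed

lemma inner_outer_sum: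
  "x \<bullet> ((\<Sum>i\<in>I. c i *\<^sub>R outer_prod (v i) (v i)) *v y) = (\<Sum>i\<in>I. c i * (v i \<bullet> x) * (v i \<bullet> y))"
  unfolding scaleR_outer_sum_mult_vec inner_sum_right inner_scaleR_right
  by (intro sum.cong refl) (simp add: inner_commute[of x])

lemma pos_semidef_outer_sum:
  assumes "\<And>i. i \<in> I \<Longrightarrow> 0 \<le> c i"
  shows "pos_semidef (\<Sum>i\<in>I. c i *\<^sub>R outer_prod (v i) (v i))"
  unfolding pos_semidef_def inner_outer_sum
proof (intro conjI allI sum_nonneg)
  show "0 \<le> c i * (v i \<bullet> x) * (v i \<bullet> x)" if "i \<in> I" for x i
    unfolding mult.assoc by (intro mult_nonneg_nonneg assms that zero_le_square)
qed (simp add: transpose_sum transpose_scalar transpose_outer_prod)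

lemma trace_outer_sum:
  assumes "orthonormal_upto r v" "I \<subseteq> {..<r}"
  shows "trace (\<Sum>i\<in>I. c i *\<^sub>R outer_prod (v i) (v i)) = (\<Sum>i\<in>I. c i)"
  unfolding trace_sum trace_scaleR trace_outer_prod
  using orthonormal_uptoD[OF assms(1)] assms(2) by (intro sum.cong refl) (simp add: subset_iff)

section \<open>Nuclear norms and truncated decompositions\<close>

lemma is_svd_squareD:
  fixes A :: "real^'n^'n"
  assumes "is_svd A u s v"
  shows "orthonormal_upto CARD('n) u" "orthonormal_upto CARD('n) v"
    and "\<And>i. i < CARD('n) \<Longrightarrow> 0 \<le> s i" "\<And>i j. i \<le> j \<Longrightarrow> j < CARD('n) \<Longrightarrow> s j \<le> s i"
    and "A = (\<Sum>i<CARD('n). s i *\<^sub>R outer_prod (u i) (v i))"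
  using assms unfolding is_svd_def min_dim_def min.idem by blast+

text \<open>Every decomposition gives the trace as the sum of its singular values, so the
  description in \<open>nuclear_norm\<close> is well defined here.\<close>

lemma nuclear_norm_pos_semidef:
  fixes A :: "real^'n^'n"
  assumes "pos_semidef A"
  shows "nuclear_norm A = trace A"
proof -
  have tr: "trace A = (\<Sum>i<CARD('n). s i)" if "is_svd A u s v" for u s v
  proof -
    note svd = is_svd_squareD[OF pos_semidef_svd_symmetric(2)[OF assms that]]
    show ?thesis using trace_outer_sum[OF svd(1) order_refl, of s] svd(5) by simp
  qed
  obtain s v where "is_svd A v s v" using pos_semidef_svd_exists[OF assms] .
  with tr[OF this] show ?thesis unfolding nuclear_norm_def min_dim_def min.idem
    using tr by (intro the_equality) metis+
qed

text \<open>Makes the given truncation and its remainder diagonal in one eigenbasis, whichever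
  decomposition produced them.\<close>

lemma truncated_svd_pos_semidefE:
  fixes A :: "real^'n^'n"
  assumes psd: "pos_semidef A" and "is_truncated_svd k A A_k" and k: "k \<le> CARD('n)"
  obtains s v where "is_svd A v s v" "A_k = (\<Sum>i<k. s i *\<^sub>R outer_prod (v i) (v i))"
    "A - A_k = (\<Sum>i\<in>{k..<CARD('n)}. s i *\<^sub>R outer_prod (v i) (v i))"
proof -
  obtain u s v where svd: "is_svd A u s v" and A_k: "A_k = (\<Sum>i<k. s i *\<^sub>R outer_prod (u i) (v i))"
    using assms(2) k by (auto simp: is_truncated_svd_def min_dim_def min_absorb1)
  note sym = pos_semidef_svd_symmetric[OF psd svd]
  have "s i *\<^sub>R outer_prod (u i) (v i) = s i *\<^sub>R outer_prod (v i) (v i)" if "i < k" for i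
    by (rule scaleR_outer_prod_cong[OF sym(1)]) (use that k in simp)
  then have 1: "A_k = (\<Sum>i<k. s i *\<^sub>R outer_prod (v i) (v i))" unfolding A_k by (intro sum.cong) auto
  have "{..<CARD('n)} = {..<k} \<union> {k..<CARD('n)}" using k by auto
  then have "A = A_k + (\<Sum>i\<in>{k..<CARD('n)}. s i *\<^sub>R outer_prod (v i) (v i))"
    using is_svd_squareD(5)[OF sym(2)] unfolding 1 by (simp add: sum.union_disjoint ivl_disj_int)
  then have "A - A_k = (\<Sum>i\<in>{k..<CARD('n)}. s i *\<^sub>R outer_prod (v i) (v i))"
    by (simp only: add_diff_cancel_left')
  then show thesis by (rule that[OF sym(2) 1])
qed

lemma nuclear_norm_outer_tail:
  fixes A :: "real^'n^'n"
  assumes "is_svd A v s v"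
    and B: "B = (\<Sum>i\<in>{k..<CARD('n)}. s i *\<^sub>R outer_prod (v i) (v i))"
  shows "pos_semidef B" "trace B = (\<Sum>i\<in>{k..<CARD('n)}. s i)" "nuclear_norm B = (\<Sum>i\<in>{k..<CARD('n)}. s i)"
proof -
  note svd = is_svd_squareD[OF assms(1)]
  show psd: "pos_semidef B" unfolding B using svd(3) by (intro pos_semidef_outer_sum) auto
  show tr: "trace B = (\<Sum>i\<in>{k..<CARD('n)}. s i)"
    unfolding B using svd(1) by (intro trace_outer_sum) auto
  show "nuclear_norm B = (\<Sum>i\<in>{k..<CARD('n)}. s i)"
    using nuclear_norm_pos_semidef[OF psd] tr by simp
qed

section \<open>Spectral norm bounds\<close>

text \<open>Each eigendyad contributes at most \<open>s i * norm x\<close>. Thus a trace bound on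
  the Nystrom error also controls its spectral norm.\<close>

lemma spectral_norm_le_trace:
  fixes A :: "real^'n^'n"
  assumes "pos_semidef A"
  shows "spectral_norm A \<le> trace A"
proof -
  obtain s v where "is_svd A v s v" using pos_semidef_svd_exists[OF assms] .
  note svd = is_svd_squareD[OF this]
  have tr: "trace A = (\<Sum>i<CARD('n). s i)"
    using trace_outer_sum[OF svd(1) order_refl, of s] svd(5) by simp
  have "norm (A *v x) \<le> trace A * norm x" for x
  proof -
    have "norm (A *v x) \<le> (\<Sum>i<CARD('n). norm ((s i * (v i \<bullet> x)) *\<^sub>R v i))"
      by (subst svd(5)) (simp only: scaleR_outer_sum_mult_vec norm_sum)
    also have "\<dots> \<le> (\<Sum>i<CARD('n). s i * norm x)"
    proof (intro sum_mono)
      fix i assume "i \<in> {..<CARD('n)}"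
      then have i: "norm (v i) = 1" "0 \<le> s i" using svd(3) orthonormal_upto_norm[OF svd(1)] by auto
      have "\<bar>v i \<bullet> x\<bar> \<le> norm x" using Cauchy_Schwarz_ineq2[of "v i" x] i by simp
      then show "norm ((s i * (v i \<bullet> x)) *\<^sub>R v i) \<le> s i * norm x"
        using i by (simp add: abs_mult mult_left_mono)
    qed
    finally show ?thesis by (simp add: tr sum_distrib_right)
  qed
  then show ?thesis unfolding spectral_norm_def by (intro onorm_le)
qed

lemma spectral_norm_add: "spectral_norm (A + B) \<le> spectral_norm A + spectral_norm (B :: real^'n^'m)"
  using onorm_triangle[OF matrix_vector_mul_bounded_linear matrix_vector_mul_bounded_linear, of A B]
  by (simp add: spectral_norm_def matrix_vector_mult_add_rdistrib)

lemma inner_le_spectral_norm: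
  fixes B :: "real^'n^'n"
  shows "x \<bullet> (B *v x) \<le> spectral_norm B * (norm x)\<^sup>2"
proof -
  have "x \<bullet> (B *v x) \<le> norm x * norm (B *v x)" by (rule norm_cauchy_schwarz)
  also have "\<dots> \<le> norm x * (spectral_norm B * norm x)"
    unfolding spectral_norm_def by (intro mult_left_mono onorm matrix_vector_mul_bounded_linear) simp
  finally show ?thesis by (simp add: power2_eq_square mult_ac)
qed

text \<open>The tail scales each eigencoordinate by at most \<open>b\<close>, and Parseval
  concludes. The bound on \<open>s k\<close> is conditional because \<open>is_svd\<close> says
  nothing about \<open>s\<close> at \<open>CARD('n)\<close>, where the tail is empty.\<close>

lemma spectral_norm_outer_tail:
  fixes A B :: "real^'n^'n"
  assumes "is_svd A v s v" and B: "B = (\<Sum>i\<in>{k..<CARD('n)}. s i *\<^sub>R outer_prod (v i) (v i))"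
    and b: "0 \<le> b" and bound: "k < CARD('n) \<Longrightarrow> s k \<le> b"
  shows "spectral_norm B \<le> b"
proof -
  note svd = is_svd_squareD[OF assms(1)]
  have on: "orthonormal_upto DIM(real^'n) v" using svd(1) by simp
  have "norm (B *v x) \<le> b * norm x" for x
  proof (rule power2_le_imp_le)
    have "(norm (B *v x))\<^sup>2 = (\<Sum>i\<in>{k..<CARD('n)}. (s i * (v i \<bullet> x))\<^sup>2)"
      unfolding B scaleR_outer_sum_mult_vec by (intro orthonormal_upto_norm_sum[OF svd(1)]) auto
    also have "\<dots> \<le> (\<Sum>i\<in>{k..<CARD('n)}. b\<^sup>2 * (v i \<bullet> x)\<^sup>2)"
      unfolding power_mult_distrib
    proof (intro sum_mono mult_right_mono power_mono)
      fix i assume "i \<in> {k..<CARD('n)}"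
      then show "0 \<le> s i" "s i \<le> b" using svd(3,4)[of i] svd(4)[of k i] bound by auto
    qed auto
    also have "\<dots> \<le> (\<Sum>i<CARD('n). b\<^sup>2 * (v i \<bullet> x)\<^sup>2)"
      by (intro sum_mono2) auto
    also have "\<dots> = (b * norm x)\<^sup>2"
      using parseval[OF on, of x] by (simp add: power_mult_distrib flip: sum_distrib_left)
    finally show "(norm (B *v x))\<^sup>2 \<le> (b * norm x)\<^sup>2" .
  qed (use b in simp)
  then show ?thesis unfolding spectral_norm_def by (intro onorm_le)
qed

section \<open>Variational bounds for eigenvalue tails\<close>

text \<open>Courant-Fischer argument: the span of the \<open>k + 1\<close> leading eigenvectors of
  \<open>B\<close> meets the orthogonal complement of the \<open>k\<close> leading ones of
  \<open>A\<close>, and the quadratic forms are compared at a common nonzero vector.\<close>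

lemma weyl_monotone_spectral_tail:
  fixes A B :: "real^'n^'n"
  assumes A: "is_svd A v s v" and B: "is_svd B w t w"
    and le: "\<And>x. x \<bullet> (B *v x) \<le> x \<bullet> (A *v x)" and k: "k < CARD('n)"
    and A_k: "A_k = (\<Sum>i<k. s i *\<^sub>R outer_prod (v i) (v i))"
  shows "t k \<le> spectral_norm (A - A_k)"
proof -
  note svdA = is_svd_squareD[OF A] and svdB = is_svd_squareD[OF B]
  have on: "orthonormal_upto (Suc k) w" using svdB(1) k by (auto intro: orthonormal_upto_mono)
  have "\<exists>x\<in>span (w ` {..<Suc k}). x \<noteq> 0 \<and> (\<forall>i<k. v i \<bullet> x = 0)"
  proof (rule ccontr)
    assume contr: "\<not> ?thesis"
    \<comment> \<open>Without a common vector, this projection would embed a space of dimension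
      \<open>k + 1\<close> into one of dimension \<open>k\<close>.\<close>
    define f where "f x = (\<Sum>i<k. (v i \<bullet> x) *\<^sub>R v i)" for x
    have "linear f" unfolding f_def
      by (intro linear_compose_sum ballI bounded_linear.linear bounded_linear_intros)
    have onv: "orthonormal_upto k v" using svdA(1) k by (auto intro: orthonormal_upto_mono)
    have "v i \<bullet> f x = v i \<bullet> x" if "i < k" for i x
      unfolding f_def using orthonormal_upto_inner_sum[OF onv, of "{..<k}" i] that by simp
    then have "inj_on f (span (w ` {..<Suc k}))"
      using contr by (subst linear_injective_on_subspace_0[OF \<open>linear f\<close> subspace_span]) (metis inner_zero_right)
    then have "dim (f ` span (w ` {..<Suc k})) = Suc k"
      using dim_image_eq[OF \<open>linear f\<close>, of "span (w ` {..<Suc k})", unfolded span_span] orthonormal_upto_dim_span[OF on] by simp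
    moreover have "f ` span (w ` {..<Suc k}) \<subseteq> span (v ` {..<k})"
      unfolding f_def by (intro image_subsetI span_sum span_scale span_base) simp
    then have "dim (f ` span (w ` {..<Suc k})) \<le> k"
      using orthonormal_upto_dim_span[OF onv] dim_subset by metis
    ultimately show False by simp
  qed
  then obtain x where xw: "x \<in> span (w ` {..<Suc k})" "x \<noteq> 0" and xv: "\<And>i. i < k \<Longrightarrow> v i \<bullet> x = 0" by auto
  have 0: "w i \<bullet> x = 0" if "k < i" "i < CARD('n)" for i
  proof -
    have "orthogonal (w i) y" if "y \<in> w ` {..<Suc k}" for y
      using that \<open>k < i\<close> \<open>i < CARD('n)\<close> k orthonormal_uptoD[OF svdB(1), of i] by (auto simp: orthogonal_def)
    from orthogonal_to_span[OF xw(1) this] show ?thesis by (simp add: orthogonal_def)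
  qed
  have on': "orthonormal_upto DIM(real^'n) w" using svdB(1) by simp
  have "t k * (norm x)\<^sup>2 = (\<Sum>i<CARD('n). t k * (w i \<bullet> x)\<^sup>2)"
    using parseval[OF on', of x] by (simp flip: sum_distrib_left)
  also have "\<dots> \<le> (\<Sum>i<CARD('n). t i * (w i \<bullet> x)\<^sup>2)"
  proof (intro sum_mono)
    fix i assume "i \<in> {..<CARD('n)}"
    then show "t k * (w i \<bullet> x)\<^sup>2 \<le> t i * (w i \<bullet> x)\<^sup>2"
      using 0[of i] svdB(4)[of i k] k by (cases "k < i") (auto intro: mult_right_mono)
  qed
  also have "\<dots> = x \<bullet> (B *v x)"
    unfolding svdB(5)[THEN arg_cong, of "\<lambda>B. x \<bullet> (B *v x)"] inner_outer_sum
    by (simp add: power2_eq_square mult_ac)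
  also have "\<dots> \<le> x \<bullet> (A *v x)" by (rule le)
  also have "A_k *v x = 0" unfolding A_k scaleR_outer_sum_mult_vec using xv by simp
  then have "x \<bullet> (A *v x) = x \<bullet> ((A - A_k) *v x)" by (simp add: matrix_vector_mult_diff_rdistrib)
  also have "\<dots> \<le> spectral_norm (A - A_k) * (norm x)\<^sup>2" by (rule inner_le_spectral_norm)
  finally show ?thesis using xw(2) by simp
qed

text \<open>In the eigenbasis of \<open>B\<close> the right side is a weighted sum of eigenvalues,
  with weights in [0, 1] of total \<open>CARD('n) - k\<close>. It is smallest when all weight sits
  on the smallest eigenvalues.\<close>

lemma ky_fan_tail:
  fixes B :: "real^'n^'n"
  assumes B: "is_svd B w t w" and on: "orthonormal_upto CARD('n) v" and k: "k \<le> CARD('n)"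
  shows "(\<Sum>i\<in>{k..<CARD('n)}. t i) \<le> (\<Sum>j\<in>{k..<CARD('n)}. v j \<bullet> (B *v v j))"
proof (cases "k < CARD('n)")
  case True
  note svd = is_svd_squareD[OF B]
  have onw: "orthonormal_upto DIM(real^'n) w" and onv: "orthonormal_upto DIM(real^'n) v"
    using svd(1) on by simp_all
  define c where "c i = (\<Sum>j\<in>{k..<CARD('n)}. (w i \<bullet> v j)\<^sup>2)" for i
  have c0: "0 \<le> c i" for i by (simp add: c_def sum_nonneg)
  have c1: "c i \<le> 1" if "i < CARD('n)" for i
  proof -
    have "c i \<le> (\<Sum>j<CARD('n). (v j \<bullet> w i)\<^sup>2)"
      unfolding c_def by (subst inner_commute, intro sum_mono2) auto
    also have "\<dots> = 1" using parseval[OF onv, of "w i"] orthonormal_upto_norm[OF svd(1) that] by simp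
    finally show ?thesis .
  qed
  have "(\<Sum>i<CARD('n). c i) = (\<Sum>j\<in>{k..<CARD('n)}. \<Sum>i<CARD('n). (w i \<bullet> v j)\<^sup>2)"
    unfolding c_def by (rule sum.swap)
  also have "\<dots> = (\<Sum>j\<in>{k..<CARD('n)}. 1)"
    using parseval[OF onw] orthonormal_upto_norm[OF on] by (intro sum.cong) auto
  finally have csum: "(\<Sum>i<CARD('n). c i) = real (CARD('n) - k)" by simp
  have rhs: "(\<Sum>j\<in>{k..<CARD('n)}. v j \<bullet> (B *v v j)) = (\<Sum>i<CARD('n). t i * c i)"
  proof -
    have "v j \<bullet> (B *v v j) = (\<Sum>i<CARD('n). t i * (w i \<bullet> v j)\<^sup>2)" for j
      by (subst svd(5)) (simp add: inner_outer_sum power2_eq_square mult_ac)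
    then show ?thesis unfolding c_def sum_distrib_left by (simp only:) (rule sum.swap)
  qed
  \<comment> \<open>Deviation from the extremal weights: nonnegative before \<open>k\<close>,
    nonpositive from \<open>k\<close> on, with sum zero. Replacing \<open>t i\<close> by the pivot
    \<open>t k\<close> therefore cannot increase the weighted sum.\<close>
  define e where "e i = c i - (if i < k then 0 else 1)" for i
  have "(\<Sum>i<CARD('n). if i < k then 0 else 1 :: real) = real (CARD('n) - k)"
  proof -
    have "(\<Sum>i<CARD('n). if i < k then 0 else 1 :: real) = (\<Sum>i\<in>{k..<CARD('n)}. 1)"
      by (intro sum.mono_neutral_cong_right) auto
    then show ?thesis by simp
  qed
  then have esum: "(\<Sum>i<CARD('n). e i) = 0" by (simp add: e_def sum_subtractf csum)
  have "0 = (\<Sum>i<CARD('n). t k * e i)" by (simp add: esum flip: sum_distrib_left)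
  also have "\<dots> \<le> (\<Sum>i<CARD('n). t i * e i)"
  proof (intro sum_mono)
    fix i assume "i \<in> {..<CARD('n)}"
    then show "t k * e i \<le> t i * e i"
      using svd(4)[of i k] svd(4)[of k i] c0[of i] c1[of i] True
      by (auto simp: e_def intro: mult_right_mono mult_right_mono_neg)
  qed
  also have "\<dots> = (\<Sum>i<CARD('n). t i * c i) - (\<Sum>i<CARD('n). if i < k then 0 else t i)"
    unfolding sum_subtractf[symmetric] by (intro sum.cong) (auto simp: e_def algebra_simps)
  also have "(\<Sum>i<CARD('n). if i < k then 0 else t i) = (\<Sum>i\<in>{k..<CARD('n)}. t i)"
    by (intro sum.mono_neutral_cong_right) auto
  finally show ?thesis unfolding rhs by simp
qed simp

subsection \<open>The pseudo-inverse and the Nystrom approximation\<close>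

definition is_pinv :: "real^'n^'m \<Rightarrow> real^'m^'n \<Rightarrow> bool" where
  "is_pinv B X \<longleftrightarrow> B ** X ** B = B \<and> X ** B ** X = X \<and>
                    transpose (B ** X) = B ** X \<and> transpose (X ** B) = X ** B"

text \<open>\<open>B ** X\<close> and \<open>B ** Y\<close> are orthogonal projections onto the same
  column space, hence equal; likewise on the other side. The equation \<open>X ** B ** X = X\<close>
  then recovers \<open>X\<close>.\<close>

lemma is_pinv_unique:
  assumes X: "is_pinv B X" and Y: "is_pinv B Y"
  shows "X = Y"
proof -
  have BX: "B ** X = B ** Y"
  proof -
    have "B ** X = (B ** Y) ** (B ** X)" using Y by (simp add: is_pinv_def matrix_mul_assoc)
    also have "\<dots> = transpose ((B ** X) ** (B ** Y))"
      using X Y by (simp only: is_pinv_def matrix_transpose_mul[of "B ** X"])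
    also have "(B ** X) ** (B ** Y) = B ** Y" using X by (simp add: is_pinv_def matrix_mul_assoc)
    also have "transpose (B ** Y) = B ** Y" using Y by (simp add: is_pinv_def)
    finally show ?thesis .
  qed
  have XB: "X ** B = Y ** B"
  proof -
    have "X ** B = (X ** B) ** (Y ** B)" using Y by (simp add: is_pinv_def flip: matrix_mul_assoc)
    also have "\<dots> = transpose ((Y ** B) ** (X ** B))"
      using X Y by (simp only: is_pinv_def matrix_transpose_mul[of "Y ** B"])
    also have "(Y ** B) ** (X ** B) = Y ** B" using X by (simp add: is_pinv_def flip: matrix_mul_assoc)
    also have "transpose (Y ** B) = Y ** B" using Y by (simp add: is_pinv_def)
    finally show ?thesis .
  qed
  have "X = (X ** B) ** X" using X by (simp add: is_pinv_def)
  also have "\<dots> = Y ** (B ** X)" by (simp add: XB matrix_mul_assoc)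
  also have "\<dots> = Y" using Y by (simp add: BX is_pinv_def matrix_mul_assoc)
  finally show ?thesis .
qed

lemma pinv_eqI: "is_pinv B X \<Longrightarrow> pinv B = X"
  unfolding pinv_def is_pinv_def[symmetric] by (blast intro: the_equality is_pinv_unique)

lemma pinv_pos_semidef:
  fixes G :: "real^'n^'n"
  assumes "pos_semidef G"
  shows "pos_semidef (pinv G)" "G ** pinv G ** G = G"
proof -
  obtain s v where "is_svd G v s v" using pos_semidef_svd_exists[OF assms] .
  note svd = is_svd_squareD[OF this]
  \<comment> \<open>The convention \<open>inverse 0 = 0\<close> makes this vanish on the kernel of
    \<open>G\<close>, as the pseudo-inverse must.\<close>
  define X where "X = (\<Sum>i<CARD('n). inverse (s i) *\<^sub>R outer_prod (v i) (v i))"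
  have X: "pos_semidef X"
    unfolding X_def by (intro pos_semidef_outer_sum) (simp add: svd(3))
  have on: "orthonormal_upto DIM(real^'n) v" using svd(1) by simp
  have vX: "v j \<bullet> (X *v x) = inverse (s j) * (v j \<bullet> x)" if "j < CARD('n)" for j x
    unfolding X_def scaleR_outer_sum_mult_vec using orthonormal_upto_inner_sum[OF svd(1) order_refl that] that by simp
  have "v j \<bullet> ((\<Sum>i<CARD('n). s i *\<^sub>R outer_prod (v i) (v i)) *v x) = s j * (v j \<bullet> x)" if "j < CARD('n)" for j x
    unfolding scaleR_outer_sum_mult_vec using orthonormal_upto_inner_sum[OF svd(1) order_refl that] that by simp
  then have vG: "v j \<bullet> (G *v x) = s j * (v j \<bullet> x)" if "j < CARD('n)" for j x
    using that svd(5) by simp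
  have eqI: "B = C" if "\<And>j x. j < CARD('n) \<Longrightarrow> v j \<bullet> (B *v x) = v j \<bullet> (C *v x)" for B C :: "real^'n^'n"
    unfolding matrix_eq using that by (intro allI orthonormal_basis_eqI[OF on]) simp
  have GX: "G ** X = X ** G"
    by (rule eqI) (simp add: vX vG flip: matrix_vector_mul_assoc)
  have "is_pinv G X" unfolding is_pinv_def
  proof (intro conjI)
    show "G ** X ** G = G" "X ** G ** X = X"
      by (rule eqI; simp add: vX vG flip: matrix_vector_mul_assoc; simp add: field_simps)+
    show "transpose (G ** X) = G ** X" "transpose (X ** G) = X ** G"
      by (simp_all add: matrix_transpose_mul pos_semidefD(1)[OF X] pos_semidefD(1)[OF assms] GX)
  qed
  then show "pos_semidef (pinv G)" "G ** pinv G ** G = G"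
    using X by (simp_all add: pinv_eqI is_pinv_def)
qed

lemma
  fixes A :: "real^'n^'n" and W :: "real^'n^'l"
  assumes A: "pos_semidef A"
  shows nystrom_pos_semidef: "pos_semidef (nystrom A W)"
    and nystrom_error_pos_semidef: "pos_semidef (A - nystrom A W)"
    and nystrom_error_annihilates: "(A - nystrom A W) *v (transpose W *v y) = 0"
proof -
  define G X where "G = W ** A ** transpose W" and "X = pinv G"
  have "pos_semidef G" unfolding G_def by (rule pos_semidef_congruence[OF A])
  note X = pinv_pos_semidef[OF this, folded X_def]
  have At: "transpose A = A" using A by (rule pos_semidefD)
  have N: "nystrom A W = transpose (W ** A) ** X ** (W ** A)"
    by (simp add: nystrom_def X_def G_def)
  show psd: "pos_semidef (nystrom A W)"
    unfolding N using pos_semidef_congruence[OF X(1), of "transpose (W ** A)"] by simp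
  have Nv: "nystrom A W *v x = A *v (transpose W *v (X *v (W *v (A *v x))))" for x
    unfolding N matrix_transpose_mul At by (simp add: matrix_vector_mul_assoc matrix_mul_assoc)
  have Gv: "W *v (A *v (transpose W *v y)) = G *v y" for y
    unfolding G_def by (simp add: matrix_vector_mul_assoc matrix_mul_assoc)
  have GXG: "G *v (X *v (G *v y)) = G *v y" for y
    using X(2) by (simp add: matrix_vector_mul_assoc matrix_mul_assoc)
  show ann: "(A - nystrom A W) *v (transpose W *v y) = 0" for y
  proof -
    \<comment> \<open>The error at \<open>transpose W *v y\<close> is \<open>A *v z\<close>. Even
      for singular \<open>G\<close>, the identity \<open>G ** X ** G = G\<close> makes the quadratic
      form of \<open>A\<close> vanish at \<open>z\<close>.\<close>
    define z where "z = transpose W *v (y - X *v (G *v y))"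
    have "z \<bullet> (A *v z) = (y - X *v (G *v y)) \<bullet> (G *v (y - X *v (G *v y)))"
      unfolding z_def transpose_mult_inner Gv ..
    also have "G *v (y - X *v (G *v y)) = 0" by (simp add: matrix_vector_mult_diff_distrib GXG)
    finally have "A *v z = 0" using pos_semidef_kernel[OF A] by simp
    moreover have "(A - nystrom A W) *v (transpose W *v y) = A *v z"
      unfolding z_def matrix_vector_mult_diff_distrib matrix_vector_mult_diff_rdistrib Nv Gv ..
    ultimately show ?thesis by simp
  qed
  show "pos_semidef (A - nystrom A W)"
    unfolding pos_semidef_def
  proof (intro conjI allI)
    show sym: "transpose (A - nystrom A W) = A - nystrom A W"
      by (simp add: transpose_diff At pos_semidefD(1)[OF psd])
    fix x
    \<comment> \<open>Completing the square: \<open>nystrom A W *v x = A *v z\<close> while the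
      error annihilates \<open>z\<close>, so its form at \<open>x\<close> is that of
      \<open>A\<close> at \<open>x - z\<close>.\<close>
    define z where "z = transpose W *v (X *v (W *v (A *v x)))"
    have Ez: "(A - nystrom A W) *v z = 0" unfolding z_def by (rule ann)
    have Ex: "(A - nystrom A W) *v x = A *v (x - z)"
      by (simp add: matrix_vector_mult_diff_rdistrib matrix_vector_mult_diff_distrib Nv z_def)
    have "z \<bullet> ((A - nystrom A W) *v x) = 0"
      using transpose_mult_inner[of "A - nystrom A W" z x] unfolding sym Ez by simp
    then have "x \<bullet> ((A - nystrom A W) *v x) = (x - z) \<bullet> (A *v (x - z))"
      by (simp add: inner_diff_left Ex)
    then show "0 \<le> x \<bullet> ((A - nystrom A W) *v x)" using pos_semidefD(2)[OF A] by simp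
  qed
qed

section \<open>Trace of the Nystrom error\<close>

lemma trace_congruence_svd:
  fixes A :: "real^'n^'n" and H :: "real^'n^'m"
  assumes "is_svd A v s v"
  shows "trace (H ** A ** transpose H) = (\<Sum>j<CARD('n). s j * (norm (H *v v j))\<^sup>2)"
proof -
  have "x \<bullet> ((H ** A ** transpose H) *v x) = (\<Sum>j<CARD('n). s j * ((H *v v j) \<bullet> x)\<^sup>2)" for x
  proof -
    have "x \<bullet> ((H ** A ** transpose H) *v x) = (transpose H *v x) \<bullet> (A *v (transpose H *v x))"
      unfolding transpose_mult_inner by (simp only: matrix_vector_mul_assoc matrix_mul_assoc)
    also have "\<dots> = (\<Sum>j<CARD('n). s j * (v j \<bullet> (transpose H *v x)) * (v j \<bullet> (transpose H *v x)))"
      unfolding is_svd_squareD(5)[OF assms, THEN arg_cong, of "\<lambda>A. (transpose H *v x) \<bullet> (A *v (transpose H *v x))"]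
        inner_outer_sum ..
    finally show ?thesis by (simp add: transpose_mult_vec_inner power2_eq_square mult_ac)
  qed
  then have "trace (H ** A ** transpose H) = (\<Sum>i\<in>UNIV. \<Sum>j<CARD('n). s j * ((H *v v j) $ i)\<^sup>2)"
    unfolding trace_eq_sum_axis by (simp add: inner_axis)
  also have "\<dots> = (\<Sum>j<CARD('n). s j * (\<Sum>i\<in>UNIV. ((H *v v j) $ i)\<^sup>2))"
    by (subst sum.swap) (simp add: sum_distrib_left)
  finally show ?thesis unfolding power2_norm_eq_inner inner_vec_def by (simp add: power2_eq_square)
qed

text \<open>Since \<open>E *v (transpose W *v y) = 0\<close>, \<open>E\<close> is unchanged by the congruence with any \<open>mat 1 - C ** W\<close>;
  this is the optimality of the Nystrom approximation among approximations factoring through \<open>W\<close>.\<close>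
lemma trace_nystrom_error_le:
  fixes A :: "real^'n^'n" and W :: "real^'n^'l"
  assumes A: "pos_semidef A" and H: "H = mat 1 - C ** W"
  shows "trace (A - nystrom A W) \<le> trace (H ** A ** transpose H)"
proof (rule trace_mono)
  fix x
  let ?E = "A - nystrom A W"
  note E = nystrom_error_pos_semidef[OF A, of W]
  define y where "y = transpose H *v x"
  have "y = x - transpose W *v (transpose C *v x)"
    by (simp add: y_def H transpose_diff matrix_transpose_mul matrix_vector_mult_diff_rdistrib matrix_vector_mul_assoc)
  then have Ey: "?E *v y = ?E *v x"
    by (simp only: matrix_vector_mult_diff_distrib nystrom_error_annihilates[OF A] diff_zero)
  have "x \<bullet> (?E *v x) = (?E *v y) \<bullet> x" by (simp only: Ey inner_commute)
  also have "\<dots> = y \<bullet> (?E *v x)" by (rule pos_semidef_inner_commute[OF E])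
  also have "\<dots> = y \<bullet> (?E *v y)" by (simp only: Ey)
  also have "\<dots> \<le> y \<bullet> (A *v y)"
    using pos_semidefD(2)[OF nystrom_pos_semidef[OF A], of y W]
    by (simp add: matrix_vector_mult_diff_rdistrib inner_diff_right)
  also have "\<dots> = x \<bullet> ((H ** A ** transpose H) *v x)"
    unfolding y_def transpose_mult_inner by (simp only: matrix_vector_mul_assoc matrix_mul_assoc)
  finally show "x \<bullet> (?E *v x) \<le> x \<bullet> ((H ** A ** transpose H) *v x)" .
qed

subsection \<open>Consequences of the subspace embedding properties\<close>

text \<open>\<open>C\<close> solves the sketched least-squares problem on the leading span through
  its normal equations. For a tail vector the solution stays in that span, so Pythagoras yields the
  leading \<open>1\<close> in the bound.\<close>

lemma subspace_embedding_left_inverse: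
  fixes W :: "real^'n^'l"
  assumes on: "orthonormal_upto CARD('n) v" and d: "d \<le> CARD('n)"
    and emb: "\<And>x. x \<in> span (v ` {..<d}) \<Longrightarrow> 2/3 * (norm x)\<^sup>2 \<le> (norm (W *v x))\<^sup>2"
  obtains C where "\<And>i. i < d \<Longrightarrow> C *v (W *v v i) = v i"
    and "\<And>j. d \<le> j \<Longrightarrow> j < CARD('n) \<Longrightarrow>
      (norm (v j - C *v (W *v v j)))\<^sup>2 \<le> 1 + 9/4 * (\<Sum>i<d. ((W *v v i) \<bullet> (W *v v j))\<^sup>2)"
proof -
  define P where "P = (\<Sum>i<d. 1 *\<^sub>R outer_prod (v i) (v i))"
  have Pv: "P *v x = (\<Sum>i<d. (v i \<bullet> x) *\<^sub>R v i)" for x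
    unfolding P_def scaleR_outer_sum_mult_vec by simp
  have P: "pos_semidef P" unfolding P_def by (intro pos_semidef_outer_sum) simp
  have sub: "{..<d} \<subseteq> {..<CARD('n)}" using d by auto
  have P_span: "P *v x \<in> span (v ` {..<d})" for x
    unfolding Pv by (intro span_sum span_scale span_base) simp
  have vP: "v j \<bullet> (P *v x) = (if j < d then v j \<bullet> x else 0)" if "j < CARD('n)" for j x
    unfolding Pv using orthonormal_upto_inner_sum[OF on sub that] by simp
  have PP: "P *v (P *v x) = P *v x" for x
    unfolding Pv[of "P *v x"] using vP d by (subst Pv) (intro sum.cong, auto)
  have P_low: "P *v v i = v i" if "i < d" for i
  proof -
    have "P *v v i = (\<Sum>k<d. if k = i then v i else 0)"
      unfolding Pv using that d by (intro sum.cong) (auto simp: orthonormal_uptoD[OF on])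
    then show ?thesis using that by simp
  qed
  have P_high: "P *v v j = 0" if "d \<le> j" "j < CARD('n)" for j
    unfolding Pv using that by (intro sum.neutral) (auto simp: orthonormal_uptoD[OF on])
  note P_comm = pos_semidef_inner_commute[OF P]
  have P_ker: "P *v (x - P *v x) = 0" for x
    by (simp add: matrix_vector_mult_diff_distrib PP)

  text \<open>The restriction of \<open>transpose W ** W\<close> to the range of \<open>P\<close>, extended by the identity on the
    orthogonal complement to make it invertible.\<close>
  define G where "G = P ** transpose W ** W ** P + (mat 1 - P)"
  have Gv: "G *v x = P *v (transpose W *v (W *v (P *v x))) + (x - P *v x)" for x
    by (simp add: G_def matrix_vector_mult_add_rdistrib matrix_vector_mult_diff_rdistrib
        matrix_vector_mul_assoc matrix_mul_assoc)
  have G_coercive: "2/3 * (norm x)\<^sup>2 \<le> x \<bullet> (G *v x)" for x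
  proof -
    have orth: "(P *v x) \<bullet> (x - P *v x) = 0"
      using P_comm[of x "x - P *v x"] by (simp only: P_ker inner_zero_right)
    have "x \<bullet> (P *v (transpose W *v (W *v (P *v x)))) = (norm (W *v (P *v x)))\<^sup>2"
      unfolding P_comm[symmetric] transpose_mult_vec_inner power2_norm_eq_inner ..
    moreover have "x \<bullet> (x - P *v x) = (norm (x - P *v x))\<^sup>2"
      using orth by (simp add: power2_norm_eq_inner inner_diff_left)
    ultimately have "x \<bullet> (G *v x) = (norm (W *v (P *v x)))\<^sup>2 + (norm (x - P *v x))\<^sup>2"
      by (simp add: Gv inner_add_right)
    moreover have "(norm x)\<^sup>2 = (norm (P *v x))\<^sup>2 + (norm (x - P *v x))\<^sup>2"
      using orth by (simp add: power2_norm_eq_inner inner_diff_left inner_diff_right inner_commute)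
    moreover have "2/3 * (norm (P *v x))\<^sup>2 \<le> (norm (W *v (P *v x)))\<^sup>2"
      by (rule emb[OF P_span])
    ultimately show ?thesis using zero_le_power2[of "norm (x - P *v x)"] by linarith
  qed
  have G_lower: "2/3 * norm x \<le> norm (G *v x)" for x
  proof (cases "x = 0")
    case False
    have "2/3 * norm x * norm x \<le> norm (G *v x) * norm x"
      using order_trans[OF G_coercive norm_cauchy_schwarz, of x] by (simp add: power2_eq_square mult_ac)
    then show ?thesis using False by simp
  qed simp
  have "\<exists>K. K ** G = mat 1"
    unfolding matrix_left_invertible_ker
  proof (intro allI impI)
    fix x assume "G *v x = 0"
    then show "x = 0" using G_lower[of x] by simp
  qed
  then obtain K where K: "K ** G = mat 1" by blast
  then have "G ** K = mat 1" by (simp add: matrix_left_right_inverse)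
  then have GK: "G *v (K *v x) = x" for x by (simp add: matrix_vector_mul_assoc)
  define C where "C = K ** P ** transpose W"
  have Cv: "C *v y = K *v (P *v (transpose W *v y))" for y
    by (simp add: C_def matrix_vector_mul_assoc matrix_mul_assoc)
  show thesis
  proof (rule that)
    fix i assume i: "i < d"
    have "P *v (transpose W *v (W *v v i)) = G *v v i" by (simp add: Gv P_low i)
    then have "C *v (W *v v i) = K *v (G *v v i)" by (simp add: Cv)
    also have "\<dots> = v i" by (simp add: matrix_vector_mul_assoc K)
    finally show "C *v (W *v v i) = v i" .
  next
    fix j assume j: "d \<le> j" "j < CARD('n)"
    define y b where "y = C *v (W *v v j)" and "b = P *v (transpose W *v (W *v v j))"
    have Gy: "G *v y = b" by (simp add: y_def b_def Cv GK)
    \<comment> \<open>On the complement of the range of \<open>P\<close>, \<open>G\<close> acts as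
      the identity, and the right side \<open>b\<close> has no component there.\<close>
    have "P *v y = y"
    proof -
      have "P *v (G *v y) = G *v y - (y - P *v y)"
        by (simp only: Gv matrix_vector_right_distrib PP P_ker) simp
      moreover have "P *v (G *v y) = G *v y" by (simp add: Gy b_def PP)
      ultimately show ?thesis by simp
    qed
    then have "v j \<bullet> y = 0" using vP[OF j(2), of y] j(1) by simp
    then have "(norm (v j - y))\<^sup>2 = 1 + (norm y)\<^sup>2"
      using orthonormal_upto_norm[OF on j(2)]
      by (simp add: power2_norm_eq_inner inner_diff_left inner_diff_right inner_commute norm_eq_1)
    \<comment> \<open>Source of the constant 9/4, the inverse square of the coercivity constant
      2/3.\<close>
    moreover have "(2/3 * norm y)\<^sup>2 \<le> (norm b)\<^sup>2"
      using G_lower[of y] by (intro power_mono) (auto simp: Gy)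
    moreover have "(norm b)\<^sup>2 = (\<Sum>i<d. ((W *v v i) \<bullet> (W *v v j))\<^sup>2)"
      unfolding b_def Pv transpose_mult_vec_inner by (rule orthonormal_upto_norm_sum[OF on sub])
    ultimately show "(norm (v j - C *v (W *v v j)))\<^sup>2 \<le> 1 + 9/4 * (\<Sum>i<d. ((W *v v i) \<bullet> (W *v v j))\<^sup>2)"
      by (simp add: y_def[symmetric] power_mult_distrib power_divide)
  qed
qed

text \<open>\<open>H\<close> kills the leading \<open>d\<close> eigenvectors, so only tail
  eigenvalues survive, each weighted by a squared residual. The \<open>d\<close> cross terms of at
  most \<open>\<epsilon> / real d\<close> add up to at most \<open>\<epsilon>\<close>.\<close>

lemma trace_nystrom_error_bound:
  fixes A :: "real^'n^'n" and W :: "real^'n^'l"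
  assumes A: "pos_semidef A" and svd: "is_svd A v s v" and d: "d \<le> CARD('n)"
    and emb: "\<And>x. x \<in> span (v ` {..<d}) \<Longrightarrow> 2/3 * (norm x)\<^sup>2 \<le> (norm (W *v x))\<^sup>2"
    and cross: "\<And>i j. i < d \<Longrightarrow> d \<le> j \<Longrightarrow> j < CARD('n) \<Longrightarrow> ((W *v v i) \<bullet> (W *v v j))\<^sup>2 \<le> \<epsilon> / real d"
    and "0 \<le> \<epsilon>"
  shows "trace (A - nystrom A W) \<le> (1 + 9/4 * \<epsilon>) * (\<Sum>j\<in>{d..<CARD('n)}. s j)"
proof -
  note svdD = is_svd_squareD[OF svd]
  obtain C where C: "\<And>i. i < d \<Longrightarrow> C *v (W *v v i) = v i"
    "\<And>j. d \<le> j \<Longrightarrow> j < CARD('n) \<Longrightarrow>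
      (norm (v j - C *v (W *v v j)))\<^sup>2 \<le> 1 + 9/4 * (\<Sum>i<d. ((W *v v i) \<bullet> (W *v v j))\<^sup>2)"
    using subspace_embedding_left_inverse[OF svdD(1) d emb] by blast
  define H where "H = mat 1 - C ** W"
  have Hv: "H *v x = x - C *v (W *v x)" for x
    by (simp add: H_def matrix_vector_mult_diff_rdistrib matrix_vector_mul_assoc)
  have "trace (A - nystrom A W) \<le> (\<Sum>j<CARD('n). s j * (norm (H *v v j))\<^sup>2)"
    using trace_nystrom_error_le[OF A H_def] trace_congruence_svd[OF svd] by metis
  also have "\<dots> = (\<Sum>j\<in>{d..<CARD('n)}. s j * (norm (H *v v j))\<^sup>2)"
    by (intro sum.mono_neutral_right) (auto simp: Hv C(1))
  also have "\<dots> \<le> (\<Sum>j\<in>{d..<CARD('n)}. s j * (1 + 9/4 * \<epsilon>))"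
  proof (intro sum_mono mult_left_mono)
    fix j assume "j \<in> {d..<CARD('n)}"
    then have j: "d \<le> j" "j < CARD('n)" by auto
    show "0 \<le> s j" using svdD(3) j by simp
    have "(\<Sum>i<d. ((W *v v i) \<bullet> (W *v v j))\<^sup>2) \<le> (\<Sum>i<d. \<epsilon> / real d)"
      using cross j by (intro sum_mono) auto
    also have "\<dots> \<le> \<epsilon>" using \<open>0 \<le> \<epsilon>\<close> by simp
    finally show "(norm (H *v v j))\<^sup>2 \<le> 1 + 9/4 * \<epsilon>"
      using C(2)[OF j] unfolding Hv by linarith
  qed
  finally show ?thesis by (simp add: sum_distrib_right mult.commute)
qed

text \<open>Polarization: \<open>4 (W x \<bullet> W y)\<close> is the difference of the squared norms of \<open>W (x + y)\<close> and \<open>W (x - y)\<close>.\<close>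
lemma embedding_preserves_inner:
  fixes W :: "real^'n^'l"
  assumes plus: "\<bar>(norm (x + y))\<^sup>2 - (norm (W *v (x + y)))\<^sup>2\<bar> \<le> \<eta> * (norm (x + y))\<^sup>2"
    and minus: "\<bar>(norm (x - y))\<^sup>2 - (norm (W *v (x - y)))\<^sup>2\<bar> \<le> \<eta> * (norm (x - y))\<^sup>2"
    and "norm x = 1" "norm y = 1" "x \<bullet> y = 0"
  shows "((W *v x) \<bullet> (W *v y))\<^sup>2 \<le> \<eta>\<^sup>2"
proof -
  have sq: "(norm (x + y))\<^sup>2 = 2" "(norm (x - y))\<^sup>2 = 2"
    using assms(3-5) by (simp_all add: power2_norm_eq_inner inner_add_left inner_add_right
        inner_diff_left inner_diff_right inner_commute norm_eq_1)
  have "(norm (W *v (x + y)))\<^sup>2 - (norm (W *v (x - y)))\<^sup>2 = 4 * ((W *v x) \<bullet> (W *v y))"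
    by (simp add: power2_norm_eq_inner inner_add_left inner_add_right matrix_vector_right_distrib
        matrix_vector_mult_diff_distrib inner_diff_left inner_diff_right inner_commute)
  \<comment> \<open>Both squared norms lie within \<open>2 * \<eta>\<close> of 2, so they differ by
    at most \<open>4 * \<eta>\<close>.\<close>
  then have "\<bar>(W *v x) \<bullet> (W *v y)\<bar> \<le> \<eta>" using plus minus unfolding sq by linarith
  then show ?thesis by (metis abs_ge_zero power_mono power2_abs)
qed

section \<open>Union bounds for failure probabilities\<close>

lemma with_prob_at_least_conj:
  assumes "prob_space M" "with_prob_at_least M (1 - a) P" "with_prob_at_least M (1 - b) Q"
  shows "with_prob_at_least M (1 - (a + b)) (\<lambda>w. P w \<and> Q w)"
proof -
  interpret prob_space M by fact
  obtain E F where E: "E \<in> events" "1 - a \<le> prob E" "\<forall>x\<in>E. P x"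
    and F: "F \<in> events" "1 - b \<le> prob F" "\<forall>x\<in>F. Q x"
    using assms by (auto simp: with_prob_at_least_def)
  have "prob (E \<union> F) = prob E + prob F - prob (E \<inter> F)"
    using E F by (simp add: measure_Un3 fmeasurable_eq_sets)
  then have "1 - (a + b) \<le> prob (E \<inter> F)" using E F prob_le_1[of "E \<union> F"] by simp
  then show ?thesis using E F unfolding with_prob_at_least_def by (intro bexI[of _ "E \<inter> F"]) auto
qed

lemma with_prob_at_least_ball:
  assumes M: "prob_space M" and "finite I" and "\<And>i. i \<in> I \<Longrightarrow> with_prob_at_least M (1 - a) (P i)"
  shows "with_prob_at_least M (1 - real (card I) * a) (\<lambda>w. \<forall>i\<in>I. P i w)"
  using assms(2,3)
proof (induction I rule: finite_induct)
  case empty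
  show ?case using prob_space.prob_space[OF M] unfolding with_prob_at_least_def
    by (intro bexI[of _ "space M"]) auto
next
  case (insert i I)
  then show ?case using with_prob_at_least_conj[OF M, of a "P i" "real (card I) * a" "\<lambda>w. \<forall>i\<in>I. P i w"]
    by (simp add: algebra_simps)
qed

lemma with_prob_at_least_mono:
  assumes "with_prob_at_least M p P" "q \<le> p" "\<And>w. P w \<Longrightarrow> Q w"
  shows "with_prob_at_least M q Q"
  using assms unfolding with_prob_at_least_def by (meson order_trans)

section \<open>Errors of rank-truncated approximations\<close>

lemma truncation_error_le:
  fixes A N :: "real^'n^'n"
  assumes A: "pos_semidef A" and N: "pos_semidef N" and E: "pos_semidef (A - N)" and k: "k \<le> CARD('n)"
    and A_k: "is_truncated_svd k A A_k" and N_k: "is_truncated_svd k N N_k"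
  shows "spectral_norm (A - N_k) \<le> spectral_norm (A - A_k) + trace (A - N)"
    and "nuclear_norm (A - N_k) \<le> nuclear_norm (A - A_k) + trace (A - N)"
proof -
  obtain s v where sv: "is_svd A v s v" "A_k = (\<Sum>i<k. s i *\<^sub>R outer_prod (v i) (v i))"
    "A - A_k = (\<Sum>i\<in>{k..<CARD('n)}. s i *\<^sub>R outer_prod (v i) (v i))"
    by (rule truncated_svd_pos_semidefE[OF A A_k k])
  obtain t w where tw: "is_svd N w t w" "N_k = (\<Sum>i<k. t i *\<^sub>R outer_prod (w i) (w i))"
    "N - N_k = (\<Sum>i\<in>{k..<CARD('n)}. t i *\<^sub>R outer_prod (w i) (w i))"
    by (rule truncated_svd_pos_semidefE[OF N N_k k])
  have le: "x \<bullet> (N *v x) \<le> x \<bullet> (A *v x)" for x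
    using pos_semidefD(2)[OF E, of x] by (simp add: matrix_vector_mult_diff_rdistrib inner_diff_right)
  have split: "A - N_k = (A - N) + (N - N_k)" by simp
  note svd = is_svd_squareD[OF sv(1)]

  have "spectral_norm (N - N_k) \<le> spectral_norm (A - A_k)"
    by (rule spectral_norm_outer_tail[OF tw(1,3) _ weyl_monotone_spectral_tail[OF sv(1) tw(1) le _ sv(2)]])
       (simp_all add: spectral_norm_def onorm_pos_le matrix_vector_mul_bounded_linear)
  then show "spectral_norm (A - N_k) \<le> spectral_norm (A - A_k) + trace (A - N)"
    unfolding split using spectral_norm_add[of "A - N" "N - N_k"] spectral_norm_le_trace[OF E] by linarith

  note tailN = nuclear_norm_outer_tail[OF tw(1,3)] and tailA = nuclear_norm_outer_tail[OF sv(1,3)]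
  have val: "v j \<bullet> (A *v v j) = s j" if "j < CARD('n)" for j
  proof -
    have "v j \<bullet> (A *v v j) = (\<Sum>i<CARD('n). if i = j then s j else 0)"
      unfolding svd(5)[THEN arg_cong, of "\<lambda>A. v j \<bullet> (A *v v j)"] inner_outer_sum
      using that by (intro sum.cong) (auto simp: orthonormal_uptoD[OF svd(1)])
    then show ?thesis using that by simp
  qed
  \<comment> \<open>Ky Fan is applied to \<open>N\<close> in the eigenbasis of \<open>A\<close>,
    where the Loewner bound turns the diagonal entries into at most \<open>s j\<close>.\<close>
  have "(\<Sum>i\<in>{k..<CARD('n)}. t i) \<le> (\<Sum>j\<in>{k..<CARD('n)}. v j \<bullet> (N *v v j))"
    by (rule ky_fan_tail[OF tw(1) svd(1) k])
  also have "\<dots> \<le> (\<Sum>j\<in>{k..<CARD('n)}. v j \<bullet> (A *v v j))" by (intro sum_mono le)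
  also have "\<dots> = (\<Sum>j\<in>{k..<CARD('n)}. s j)" by (intro sum.cong) (auto simp: val)
  finally have "trace (N - N_k) \<le> nuclear_norm (A - A_k)" unfolding tailN(2) tailA(3) .
  moreover have "nuclear_norm (A - N_k) = trace (A - N) + trace (N - N_k)"
    unfolding split nuclear_norm_pos_semidef[OF pos_semidef_add[OF E tailN(1)]] trace_add ..
  ultimately show "nuclear_norm (A - N_k) \<le> nuclear_norm (A - A_k) + trace (A - N)" by simp
qed

section \<open>Application to the random embedding\<close>

lemma OSE_one_singleton:
  fixes Omega :: "'w \<Rightarrow> real^'n^'l"
  assumes "OSE M Omega \<eta> \<delta> 1" "x \<noteq> 0"
  shows "with_prob_at_least M (1 - \<delta>)
    (\<lambda>w. \<bar>(norm x)\<^sup>2 - (norm (Omega w *v x))\<^sup>2\<bar> \<le> \<eta> * (norm x)\<^sup>2)"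
proof -
  have "dim (span {x}) = 1"
    using dim_span_eq_card_independent[of "{x}"] assms(2) by simp
  then have "with_prob_at_least M (1 - \<delta>)
      (\<lambda>w. \<forall>x\<in>span {x}. \<bar>(norm x)\<^sup>2 - (norm (Omega w *v x))\<^sup>2\<bar> \<le> \<eta> * (norm x)\<^sup>2)"
    using assms(1) unfolding OSE_def by blast
  then show ?thesis by (rule with_prob_at_least_mono) (auto simp: span_base)
qed

theorem mainTheorem4:
  fixes A A_k A_d :: "real^'n^'n"
    and M :: "'w measure"
    and Omega :: "'w \<Rightarrow> real^'n^'l"
    and k d :: nat
    and \<epsilon>s \<epsilon> \<delta> N :: real
  assumes "pos_semidef A"
    and "1 \<le> k" and "k \<le> d" and "d \<le> CARD('n)"
    and "0 < \<epsilon>s" and "\<epsilon>s \<le> 1 / 2"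
    and "\<epsilon> = 4 / 9 * \<epsilon>s"
    and "0 < \<delta>" and "\<delta> < 1"
    and "N = 2 * real CARD('n) * real d + real CARD('n) + real d"
    and "prob_space M"
    and "Omega \<in> borel_measurable M"
    and "OSE M Omega (1 / 3) \<delta> d"
    and "OSE M Omega (sqrt (\<epsilon> / real d)) (\<delta> / N) 1"
    and "is_truncated_svd k A A_k"
    and "is_truncated_svd d A A_d"
  shows "with_prob_at_least M (1 - 2 * \<delta>) (\<lambda>w.
      nuclear_norm (A - nystrom A (Omega w)) \<le> (1 + \<epsilon>s) * nuclear_norm (A - A_d) \<and>
      (\<forall>Nyst_k. is_truncated_svd k (nystrom A (Omega w)) Nyst_k \<longrightarrow>
         spectral_norm (A - Nyst_k) \<le> spectral_norm (A - A_k) + 3 * nuclear_norm (A - A_d) \<and>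
         nuclear_norm (A - Nyst_k) \<le> nuclear_norm (A - A_k) + 3 * nuclear_norm (A - A_d)))"
proof -
  note A = assms(1) and d = assms(4) and M = assms(11)
  have k: "k \<le> CARD('n)" using assms(3,4) by simp
  \<comment> \<open>The eigenbasis is taken from the given \<open>A_d\<close>, so that
    \<open>A - A_d\<close> is exactly its tail. It is independent of the sample, as the embedding
    hypotheses for fixed subspaces require.\<close>
  obtain s v where sv: "is_svd A v s v"
    "A - A_d = (\<Sum>i\<in>{d..<CARD('n)}. s i *\<^sub>R outer_prod (v i) (v i))"
    by (rule truncated_svd_pos_semidefE[OF A assms(16) d])
  note tail = nuclear_norm_outer_tail[OF sv] and svd = is_svd_squareD[OF sv(1)]
  define \<eta> where "\<eta> = sqrt (\<epsilon> / real d)"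
  \<comment> \<open>A leading index, a tail index and a sign: the vectors needed for
    polarization.\<close>
  define I where "I = ({..<d} \<times> {d..<CARD('n)}) \<times> {1, -1 :: real}"
  define x where "x = (\<lambda>((i, j), \<sigma>). v i + \<sigma> *\<^sub>R v j)"
  define good where "good w \<longleftrightarrow>
      (\<forall>x\<in>span (v ` {..<d}). \<bar>(norm x)\<^sup>2 - (norm (Omega w *v x))\<^sup>2\<bar> \<le> 1/3 * (norm x)\<^sup>2) \<and>
      (\<forall>p\<in>I. \<bar>(norm (x p))\<^sup>2 - (norm (Omega w *v x p))\<^sup>2\<bar> \<le> \<eta> * (norm (x p))\<^sup>2)" for w
  have x_nonzero: "x p \<noteq> 0" if "p \<in> I" for p
  proof -
    obtain i j \<sigma> where p: "p = ((i, j), \<sigma>)" by (metis surj_pair)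
    with that have ij: "i < d" "d \<le> j" "j < CARD('n)" by (auto simp: I_def)
    have "v i \<bullet> x p = 1"
      using p ij d orthonormal_uptoD[OF svd(1), of i] by (simp add: x_def inner_add_right)
    then show ?thesis by auto
  qed
  have "with_prob_at_least M (1 - 2 * \<delta>) good"
  proof -
    have "dim (span (v ` {..<d})) = d"
      by (intro orthonormal_upto_dim_span orthonormal_upto_mono[OF svd(1) d])
    then have "with_prob_at_least M (1 - \<delta>)
        (\<lambda>w. \<forall>x\<in>span (v ` {..<d}). \<bar>(norm x)\<^sup>2 - (norm (Omega w *v x))\<^sup>2\<bar> \<le> 1/3 * (norm x)\<^sup>2)"
      using assms(13) unfolding OSE_def by blast
    moreover have "with_prob_at_least M (1 - real (card I) * (\<delta> / N))
        (\<lambda>w. \<forall>p\<in>I. \<bar>(norm (x p))\<^sup>2 - (norm (Omega w *v x p))\<^sup>2\<bar> \<le> \<eta> * (norm (x p))\<^sup>2)"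
      unfolding \<eta>_def
      by (intro with_prob_at_least_ball[OF M] OSE_one_singleton[OF assms(14)] x_nonzero) (simp_all add: I_def)
    ultimately have "with_prob_at_least M (1 - (\<delta> + real (card I) * (\<delta> / N))) good"
      unfolding good_def by (rule with_prob_at_least_conj[OF M])
    \<comment> \<open>There are \<open>2 * d * (CARD('n) - d)\<close> vectors, at most
      \<open>N\<close>, so their total failure probability is at most
      \<open>\<delta>\<close>.\<close>
    moreover have "real (card I) * (\<delta> / N) \<le> \<delta>"
    proof -
      have "card I = 2 * (d * (CARD('n) - d))" by (simp add: I_def card_cartesian_product)
      also have "\<dots> \<le> 2 * (CARD('n) * d)" by (simp add: mult.commute)
      finally have "real (card I) \<le> 2 * real CARD('n) * real d"
        by (metis mult.assoc of_nat_le_iff of_nat_mult of_nat_numeral)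
      moreover have "0 < real CARD('n)" by simp
      ultimately have "real (card I) \<le> N" "0 < N"
        unfolding assms(10) by (linarith, intro add_pos_nonneg add_nonneg_pos) simp_all
      then show ?thesis using assms(8) by (simp add: field_simps)
    qed
    ultimately show ?thesis by - (erule with_prob_at_least_mono, simp_all)
  qed
  then show ?thesis
  proof (rule with_prob_at_least_mono)
    fix w assume good: "good w"
    let ?N = "nystrom A (Omega w)"
    note N = nystrom_pos_semidef[OF A, of "Omega w"] and E = nystrom_error_pos_semidef[OF A, of "Omega w"]
    have "trace (A - ?N) \<le> (1 + 9/4 * \<epsilon>) * (\<Sum>j\<in>{d..<CARD('n)}. s j)"
    proof (rule trace_nystrom_error_bound[OF A sv(1) d])
      fix y assume "y \<in> span (v ` {..<d})"
      then have "\<bar>(norm y)\<^sup>2 - (norm (Omega w *v y))\<^sup>2\<bar> \<le> 1/3 * (norm y)\<^sup>2"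
        using good by (simp only: good_def)
      then show "2/3 * (norm y)\<^sup>2 \<le> (norm (Omega w *v y))\<^sup>2" by linarith
    next
      fix i j assume ij: "i < d" "d \<le> j" "j < CARD('n)"
      then have "((i, j), 1) \<in> I" "((i, j), -1) \<in> I" by (auto simp: I_def)
      then have bounds: "\<bar>(norm (x p))\<^sup>2 - (norm (Omega w *v x p))\<^sup>2\<bar> \<le> \<eta> * (norm (x p))\<^sup>2"
        if "p \<in> {((i, j), 1), ((i, j), -1)}" for p
        using good that unfolding good_def by blast
      have "((Omega w *v v i) \<bullet> (Omega w *v v j))\<^sup>2 \<le> \<eta>\<^sup>2"
        using bounds[of "((i, j), 1)"] bounds[of "((i, j), -1)"] ij d
        by (intro embedding_preserves_inner)
           (simp_all add: x_def orthonormal_upto_norm[OF svd(1)] orthonormal_uptoD[OF svd(1)])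
      also have "\<eta>\<^sup>2 = \<epsilon> / real d" using assms(5,7) by (simp add: \<eta>_def)
      finally show "((Omega w *v v i) \<bullet> (Omega w *v v j))\<^sup>2 \<le> \<epsilon> / real d" .
    qed (use assms(5,7) in simp)
    \<comment> \<open>The choice of \<open>\<epsilon>\<close> cancels the factor 9/4.\<close>
    then have err: "trace (A - ?N) \<le> (1 + \<epsilon>s) * nuclear_norm (A - A_d)"
      by (simp add: tail(3) assms(7))
    moreover have "(1 + \<epsilon>s) * nuclear_norm (A - A_d) \<le> 3 * nuclear_norm (A - A_d)"
      using assms(6) pos_semidef_trace_nonneg[OF tail(1)] by (intro mult_right_mono) (auto simp: tail)
    ultimately have err3: "trace (A - ?N) \<le> 3 * nuclear_norm (A - A_d)" by linarith
    show "nuclear_norm (A - ?N) \<le> (1 + \<epsilon>s) * nuclear_norm (A - A_d) \<and>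
      (\<forall>Nyst_k. is_truncated_svd k ?N Nyst_k \<longrightarrow>
         spectral_norm (A - Nyst_k) \<le> spectral_norm (A - A_k) + 3 * nuclear_norm (A - A_d) \<and>
         nuclear_norm (A - Nyst_k) \<le> nuclear_norm (A - A_k) + 3 * nuclear_norm (A - A_d))"
      using err err3 truncation_error_le[OF A N E k assms(15)]
      unfolding nuclear_norm_pos_semidef[OF E] by (meson add_left_mono order_trans)
  qed simp
qed

end
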